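(* For each integer $d\geq 3$, \[\Big[\,3-\frac{d}{(d-1)^2}\,,\,+\infty\Big]\subset\Omega_d .\]
   Context: For $\mathbf x=(x_1,\dots,x_d)\in\mathbb R^d$ let $\Pi(\mathbf x)=\prod_{i=1}^d|x_i|^{1/d}$, and let $|\cdot|$ denote the Euclidean norm. For a full-rank lattice $\Lambda\subset\mathbb R^d$ its Diophantine exponent is \[\omega(\Lambda)=\sup\{\gamma\in\mathbb R:\ \Pi(\mathbf x)\leq|\mathbf x|^{-\gamma}\text{ for infinitely many }\mathbf x\in\Lambda\}\in[0,+\infty].\] Let $\mathcal L_d$ be the space of full-rank lattices in $\mathbb R^d$ of covolume $1$, and $\Omega_d=\{\omega(\Lambda):\Lambda\in\mathcal L_d\}$ (a subset of $[0,+\infty]$; the interval in the claim includes the value $+\infty$). *)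

theory Defs
  imports "HOL-Analysis.Analysis"
begin

definition Pi_prod :: "real^'n \<Rightarrow> real" where
  "Pi_prod x = (\<Prod>i\<in>UNIV. \<bar>x $ i\<bar>) powr (1 / real CARD('n))"

definition unimodular_lattice :: "(real^'n) set \<Rightarrow> bool" where
  "unimodular_lattice L \<longleftrightarrow>
     (\<exists>A :: real^'n^'n. \<bar>det A\<bar> = 1 \<and>
        L = range (\<lambda>z :: 'n \<Rightarrow> int. A *v (\<chi> i. real_of_int (z i))))"

definition dioph_exp :: "(real^'n) set \<Rightarrow> ereal" where
  "dioph_exp L = Sup (ereal ` {\<gamma>::real.
       infinite {x \<in> L. Pi_prod x \<le> norm x powr (- \<gamma>)}})"

definition Omega :: "('n::finite) itself \<Rightarrow> ereal set" where
  "Omega _ = {dioph_exp (L :: (real^'n) set) | L. unimodular_lattice L}"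

end

theory Submission
  imports Defs
begin

text \<open>
Put \<open>\<beta> = d \<gamma> + d - 1\<close> and let \<open>\<alpha>\<close> be a real number that is approximable exactly to order
\<open>\<beta>\<close>: \<open>\<bar>q \<alpha> + p\<bar>\<close> is always \<open>\<ge> c q powr - \<beta>\<close> and infinitely often \<open>\<le> C q powr - \<beta>\<close>.
Fix two coordinates \<open>a\<close>, \<open>b\<close>, let the first form be \<open>z a + \<alpha> z b\<close> plus a generic combination of the
other coordinates, and let the remaining \<open>d - 1\<close> forms be generic. On the integer points of the
\<open>a\<close>-\<open>b\<close>-plane where the first form is small, the other forms are comparable to the height of the
point, so the product of all forms has order exactly \<open>d - 1 - \<beta> = - d \<gamma>\<close> along the good
approximations to \<open>\<alpha>\<close>.

No other integer point does better. The function \<open>\<bar>\<xi>\<bar> powr (-1/2)\<close> is locally integrable, hence the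
average of \<open>\<bar>u + \<xi> m\<bar> powr (-1/2)\<close> over \<open>\<xi>\<close> in an interval is bounded uniformly in \<open>u\<close> and the
integer \<open>m \<noteq> 0\<close>. Choosing the generic coefficients one at a time, one keeps the sum over all integer
points of the weight \<open>\<Prod>j. (1 + \<bar>z j\<bar>) powr - (\<gamma> / 2)\<close>, which is summable because \<open>\<gamma> > 2\<close> and at least
\<open>height z powr - (d \<gamma> / 2)\<close>, times the product of the inverse square roots of the forms finite. Boundedness of its terms is the required lower bound.
\<close>

section \<open>A number with prescribed exact order of approximation\<close>

text \<open>The tail of the series after \<open>S k\<close> is comparable to its first term, hence
  to \<open>b k powr - \<tau>\<close>, so the distance from \<open>b k * \<alpha>\<close> to the
  integer \<open>b k * S k\<close> is exactly of order \<open>b k powr - \<beta>\<close>. For any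
  other fraction p / q the gap between distinct fractions gives a lower bound of order
  \<open>q powr - 2\<close>, which suffices as \<beta> \<ge> 2.\<close>

lemma exists_exact_irrationality_exponent:
  fixes \<beta> :: real
  assumes "\<beta> \<ge> 2"
  obtains \<alpha> c C :: real where "0 \<le> \<alpha>" "\<alpha> \<le> 1" "c > 0"
    "\<And>p q :: int. q \<noteq> 0 \<Longrightarrow> \<bar>of_int q * \<alpha> + of_int p\<bar> \<ge> c * \<bar>of_int q\<bar> powr - \<beta>"
    "infinite {q :: int. q > 0 \<and> (\<exists>p :: int. \<bar>of_int q * \<alpha> + of_int p\<bar> \<le> C * of_int q powr - \<beta>)}"
proof -
  \<comment> \<open>\<open>\<alpha>\<close> is the sum of \<open>1 / b k\<close> with \<open>b k = 2 ^ e k\<close>, where \<open>b (Suc k)\<close> is about \<open>b k powr (\<beta> + 1)\<close>.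
    As powers of two, the \<open>b k\<close> are the reduced denominators of the partial sums.\<close>
  define \<tau> where "\<tau> = \<beta> + 1"
  define e :: "nat \<Rightarrow> nat" where "e = rec_nat 1 (\<lambda>_ m. nat \<lceil>\<tau> * real m\<rceil>)"
  have e0: "e 0 = 1" and eS: "e (Suc k) = nat \<lceil>\<tau> * real (e k)\<rceil>" for k
    by (simp_all add: e_def)
  have \<tau>3: "\<tau> \<ge> 3" using assms by (simp add: \<tau>_def)
  have e_lo: "\<tau> * real (e k) \<le> real (e (Suc k))" for k
    unfolding eS by linarith
  have e_hi: "real (e (Suc k)) \<le> \<tau> * real (e k) + 1" for k
  proof -
    have "\<tau> * real (e k) \<ge> 0" using \<tau>3 by simp
    then show ?thesis unfolding eS by linarith
  qed
  have e_ge1: "e k \<ge> 1" for k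
  proof (induction k)
    case (Suc k)
    have "3 * 1 \<le> \<tau> * real (e k)" using \<tau>3 Suc by (intro mult_mono) auto
    then show ?case using e_lo[of k] by linarith
  qed (simp add: e0)
  have e_less: "e k < e (Suc k)" for k
  proof -
    have "3 * real (e k) \<le> \<tau> * real (e k)" using \<tau>3 by (intro mult_right_mono) auto
    then show ?thesis using e_lo[of k] e_ge1[of k] by linarith
  qed
  have e_mono: "strict_mono e" by (simp add: strict_mono_Suc_iff e_less)
  have e_add: "e m + j \<le> e (m + j)" for m j
  proof (induction j)
    case (Suc j)
    then show ?case using e_less[of "m + j"] by simp
  qed simp
  define b :: "nat \<Rightarrow> real" where "b k = 2 ^ e k" for k
  have b_powr: "b k = 2 powr real (e k)" for k by (simp add: b_def powr_realpow)
  have b_pos: "b k > 0" for k by (simp add: b_def)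
  have b_ge2: "b k \<ge> 2" for k
    using power_increasing[OF e_ge1[of k], of "2::real"] by (simp add: b_def)
  have b_lo: "b k powr \<tau> \<le> b (Suc k)" for k
    unfolding b_powr powr_powr using e_lo[of k] by (simp add: mult.commute)
  \<comment> \<open>Rounding the exponent up adds at most 1 to it, hence at most a factor 2
    here.\<close>
  have b_hi: "b (Suc k) \<le> 2 * b k powr \<tau>" for k
  proof -
    have "b (Suc k) \<le> 2 powr (\<tau> * real (e k) + 1)"
      unfolding b_powr using e_hi[of k] by simp
    also have "\<dots> = 2 * b k powr \<tau>"
      unfolding b_powr powr_powr by (simp add: powr_add mult.commute)
    finally show ?thesis .
  qed
  have b_\<tau>: "b k powr \<tau> = b k * b k powr \<beta>" for k
    using b_pos[of k] by (simp add: \<tau>_def powr_add)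
  have b_\<beta>: "b k powr \<beta> \<ge> b k ^ 2" for k
    using powr_mono[OF assms, of "b k"] b_ge2[of k] by simp
  define f :: "nat \<Rightarrow> real" where "f k = 1 / b k" for k
  have f_add: "f (j + m) \<le> f m * (1/2) ^ j" for m j
  proof -
    have "b m * 2 ^ j \<le> b (j + m)"
      unfolding b_def power_add[symmetric] using e_add[of m j]
      by (intro power_increasing) (auto simp: add.commute)
    then show ?thesis using b_pos[of m] b_pos[of "j + m"]
      by (simp add: f_def field_simps)
  qed
  have f_pos: "f k > 0" for k using b_pos by (simp add: f_def)
  have f_summable: "summable (\<lambda>j. f (j + m))" for m
    by (rule summable_comparison_test[of _ "\<lambda>j. f m * (1/2) ^ j"])
      (auto intro!: exI[of _ 0] summable_mult summable_geometric simp: f_add f_pos less_imp_le)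
  have f_tail: "(\<Sum>j. f (j + m)) \<le> 2 * f m" for m
  proof -
    have "(\<Sum>j. f (j + m)) \<le> (\<Sum>j. f m * (1/2) ^ j)"
      by (intro suminf_le f_summable summable_mult summable_geometric) (auto simp: f_add)
    also have "\<dots> = 2 * f m" by (subst suminf_mult) (auto simp: suminf_geometric)
    finally show ?thesis .
  qed
  define \<alpha> where "\<alpha> = suminf f"
  define S where "S k = (\<Sum>j\<le>k. f j)" for k
  have \<alpha>_split: "\<alpha> = S k + (\<Sum>j. f (j + Suc k))" for k
    unfolding \<alpha>_def S_def using suminf_split_initial_segment[of f "Suc k"] f_summable[of 0]
    by (simp add: lessThan_Suc_atMost)
  have \<alpha>_hi: "\<alpha> - S k \<le> 2 / b (Suc k)" for k
    using \<alpha>_split[of k] f_tail[of "Suc k"] by (simp add: f_def)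
  have \<alpha>_lo: "1 / b (Suc k) \<le> \<alpha> - S k" for k
  proof -
    have "(\<Sum>j\<in>{0}. f (j + Suc k)) \<le> (\<Sum>j. f (j + Suc k))"
      by (rule sum_le_suminf[OF f_summable]) (auto simp: f_pos less_imp_le)
    then show ?thesis using \<alpha>_split[of k] by (simp add: f_def)
  qed
  define n :: "nat \<Rightarrow> int" where "n k = (\<Sum>j\<le>k. 2 ^ (e k - e j))" for k
  have n_S: "of_int (n k) = b k * S k" for k
  proof -
    have "real_of_int (n k) = (\<Sum>j\<le>k. 2 ^ (e k - e j))" by (simp add: n_def)
    also have "\<dots> = (\<Sum>j\<le>k. b k * f j)"
    proof (rule sum.cong)
      fix j assume "j \<in> {..k}"
      then have "e j \<le> e k" using e_mono by (simp add: strict_mono_less_eq)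
      then show "(2::real) ^ (e k - e j) = b k * f j" by (simp add: power_diff b_def f_def)
    qed simp
    finally show ?thesis by (simp add: S_def sum_distrib_left)
  qed
  have n_odd: "odd (n k)" for k
  proof -
    have "n k = (\<Sum>j<k. 2 ^ (e k - e j)) + 1"
      by (simp add: n_def flip: lessThan_Suc_atMost)
    moreover have "even (\<Sum>j<k. 2 ^ (e k - e j) :: int)"
      using e_mono by (intro dvd_sum) (auto simp: strict_mono_less)
    ultimately show ?thesis by simp
  qed
  have pos_case: "\<bar>of_int q * \<alpha> - of_int p\<bar> \<ge> 1/32 * of_int q powr - \<beta>" if q: "q > 0" for p q :: int
  proof -
    have "\<exists>k. 4 * of_int q * b k \<le> b (Suc k)"
    proof -
      obtain k :: nat where k: "4 * of_int q \<le> real k" using real_arch_simple by blast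
      have "real k \<le> b k"
      proof -
        have "k \<le> e k" using e_add[of 0 k] by simp
        also have "e k < 2 ^ e k" by simp
        finally have "real k < real (2 ^ e k)" by (simp only: of_nat_less_iff)
        then show ?thesis by (simp add: b_def)
      qed
      also have "b k \<le> b k ^ 2" using b_ge2[of k] by (simp add: power2_eq_square)
      also note b_\<beta>[of k]
      finally have "4 * of_int q * b k \<le> b k * b k powr \<beta>"
        using k b_pos[of k] by (simp add: mult.commute)
      then show ?thesis using b_lo[of k] unfolding b_\<tau> by (intro exI[of _ k]) simp
    qed
    \<comment> \<open>The scale belonging to q: the condition makes
      \<open>q * (\<alpha> - S k)\<close> at most half of \<open>1 / b k\<close>, and minimality
      bounds \<open>b k\<close> by a multiple of \<open>q^2\<close>.\<close>
    define k where "k = (LEAST k. 4 * of_int q * b k \<le> b (Suc k))"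
    have k: "4 * of_int q * b k \<le> b (Suc k)"
      unfolding k_def by (rule LeastI_ex) fact
    have q1: "real_of_int q \<ge> 1" using q by simp
    show ?thesis
    proof (cases "p * 2 ^ e k = n k * q")
      \<comment> \<open>Here p / q equals \<open>S k\<close>. The reduced denominator
        \<open>b k\<close> divides q, and \<open>q * \<alpha> - p\<close> is q times the
        tail.\<close>
      case True
      have "coprime (2 ^ e k) (n k)" using n_odd[of k] by simp
      moreover have "2 ^ e k dvd n k * q" using True by (metis dvd_triv_right)
      ultimately have "2 ^ e k dvd q" using coprime_dvd_mult_right_iff by blast
      then have "2 ^ e k \<le> q" using q zdvd_imp_le by blast
      then have bq: "b k \<le> of_int q" unfolding b_def
        by (metis of_int_le_iff of_int_numeral of_int_power)
      have "of_int p * b k = of_int (n k) * of_int q"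
        unfolding b_def using True by (metis of_int_mult of_int_numeral of_int_power)
      then have "of_int p = S k * of_int q" using b_pos[of k] by (simp add: n_S)
      then have "of_int q * \<alpha> - of_int p = of_int q * (\<alpha> - S k)" by (simp add: algebra_simps)
      moreover have "b k * (1 / (2 * b k powr \<tau>)) \<le> of_int q * (\<alpha> - S k)"
      proof (rule mult_mono)
        have "1 / (2 * b k powr \<tau>) \<le> 1 / b (Suc k)"
          using b_hi[of k] b_pos[of "Suc k"] by (intro frac_le) auto
        then show "1 / (2 * b k powr \<tau>) \<le> \<alpha> - S k" using \<alpha>_lo[of k] by simp
      qed (use bq q in auto)
      moreover have "b k * (1 / (2 * b k powr \<tau>)) = 1/2 * b k powr - \<beta>"
        using b_pos[of k] by (simp add: b_\<tau> powr_minus field_simps)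
      moreover have "of_int q powr - \<beta> \<le> b k powr - \<beta>"
        using bq b_pos[of k] assms by (intro powr_mono2') auto
      moreover have "of_int q powr - \<beta> \<ge> 0" by simp
      ultimately show ?thesis by linarith
    next
      \<comment> \<open>Now p / q differs from \<open>S k\<close>, so \<open>p - S k * q\<close> is
        a nonzero integer divided by \<open>b k\<close>; the tail uses up at most half of this
        gap.\<close>
      case False
      then have "1 \<le> \<bar>p * 2 ^ e k - n k * q\<bar>" by linarith
      then have "1 \<le> \<bar>real_of_int (p * 2 ^ e k - n k * q)\<bar>" by linarith
      also have "real_of_int (p * 2 ^ e k - n k * q) = b k * (of_int p - S k * of_int q)"
        by (simp add: n_S) (simp add: b_def algebra_simps)
      finally have "1 \<le> b k * \<bar>of_int p - S k * of_int q\<bar>"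
        using b_pos[of k] by (simp only: abs_mult abs_of_pos)
      then have "1 / b k \<le> \<bar>of_int p - S k * of_int q\<bar>"
        using b_pos[of k] by (simp only: pos_divide_le_eq mult.commute)
      moreover have "\<bar>of_int q * (\<alpha> - S k)\<bar> \<le> 1 / (2 * b k)"
      proof -
        have "of_int q * (\<alpha> - S k) \<le> of_int q * (2 / b (Suc k))"
          using \<alpha>_hi[of k] q by (intro mult_left_mono) auto
        also have "\<dots> \<le> 1 / (2 * b k)" using k b_pos[of k] b_pos[of "Suc k"] by (simp add: field_simps)
        finally have "of_int q * (\<alpha> - S k) \<le> 1 / (2 * b k)" .
        moreover have "\<alpha> - S k \<ge> 0" using \<alpha>_lo[of k] b_pos[of "Suc k"]
          by (meson divide_nonneg_pos order_trans zero_le_one)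
        ultimately show ?thesis using q by simp
      qed
      moreover have "of_int q * \<alpha> - of_int p = of_int q * (\<alpha> - S k) - (of_int p - S k * of_int q)"
        "1 / b k = 1 / (2 * b k) + 1 / (2 * b k)"
        by (simp_all add: algebra_simps)
      ultimately have *: "1 / (2 * b k) \<le> \<bar>of_int q * \<alpha> - of_int p\<bar>"
        by linarith
      \<comment> \<open>The condition fails at the predecessor m, so
        \<open>b k < 4 * q * b m\<close>; since \<open>b k\<close> is at least the cube of
        \<open>b m\<close>, it follows that \<open>b m\<close> is below 4 q.\<close>
      have "b k \<le> 16 * (of_int q)\<^sup>2"
      proof (cases k)
        case 0
        have "b k = 2" by (simp add: 0 b_def e0)
        then show ?thesis using one_le_power[OF q1, of 2] by linarith
      next
        case (Suc m)
        then have less: "b k < 4 * of_int q * b m"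
          using not_less_Least[of m "\<lambda>k. 4 * of_int q * b k \<le> b (Suc k)"] by (auto simp: k_def[symmetric])
        have "b m * b m ^ 2 \<le> b k"
          using b_lo[of m] b_\<beta>[of m] b_pos[of m] Suc unfolding b_\<tau>
          by (meson mult_left_mono less_imp_le order_trans)
        also note less
        finally have "b m ^ 2 < 4 * of_int q"
          using b_pos[of m] by (simp add: mult.commute)
        moreover have "b m \<le> b m ^ 2" using b_ge2[of m] by (simp add: power2_eq_square)
        ultimately have "4 * of_int q * b m \<le> 4 * of_int q * (4 * of_int q)"
          using q by (intro mult_left_mono) auto
        then show ?thesis using less by (simp add: power2_eq_square)
      qed
      then have "1 / (32 * (of_int q)\<^sup>2) \<le> 1 / (2 * b k)"
        using b_pos[of k] q1 by (intro divide_left_mono) auto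
      moreover have "1 / (32 * (of_int q)\<^sup>2) = 1/32 * real_of_int q powr - 2"
        using q1 by (simp add: powr_minus field_simps powr_numeral)
      moreover have "real_of_int q powr - \<beta> \<le> of_int q powr - 2"
        using q1 assms by (intro powr_mono) auto
      ultimately show ?thesis using * by linarith
    qed
  qed
  show thesis
  proof
    have S0: "S 0 = 1/2" by (simp add: S_def f_def b_def e0)
    show "0 \<le> \<alpha>" using \<alpha>_lo[of 0] S0 divide_pos_pos[OF zero_less_one b_pos[of "Suc 0"]] by linarith
    have "b 0 = 2" by (simp add: b_def e0)
    then have "4 \<le> b (Suc 0)" using b_\<beta>[of 0] b_lo[of 0] b_\<tau>[of 0] by simp
    then have "2 / b (Suc 0) \<le> 1/2" by (simp add: field_simps)
    then show "\<alpha> \<le> 1" using \<alpha>_hi[of 0] S0 by linarith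
    show "(0::real) < 1/32" by simp
    show "1/32 * \<bar>of_int q\<bar> powr - \<beta> \<le> \<bar>of_int q * \<alpha> + of_int p\<bar>" if "q \<noteq> 0" for p q :: int
    proof (cases "q > 0")
      case True
      then show ?thesis using pos_case[of q "- p"] by simp
    next
      case False
      then have "- q > 0" using that by simp
      from pos_case[OF this, of p] show ?thesis using False by (simp add: abs_if split: if_splits)
    qed
    \<comment> \<open>The witnesses are q = \<open>b k\<close> and p = \<open>- n k\<close>; the
      constant 2 is that of the geometric bound on the tail.\<close>
    have "range (\<lambda>k. 2 ^ e k) \<subseteq> {q :: int. q > 0 \<and>
        (\<exists>p :: int. \<bar>of_int q * \<alpha> + of_int p\<bar> \<le> 2 * of_int q powr - \<beta>)}"
    proof clarsimp
      fix k
      have "b k * \<alpha> + of_int (- n k) = b k * (\<alpha> - S k)" by (simp add: n_S algebra_simps)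
      moreover have "0 \<le> \<alpha> - S k" using \<alpha>_lo[of k] b_pos[of "Suc k"]
          by (meson divide_nonneg_pos order_trans zero_le_one)
      moreover have "b k * (\<alpha> - S k) \<le> 2 * b k powr - \<beta>"
      proof -
        have "\<alpha> - S k \<le> 2 / (b k * b k powr \<beta>)"
          using \<alpha>_hi[of k] b_lo[of k] b_pos[of k] b_pos[of "Suc k"] unfolding b_\<tau>
          by (smt (verit) divide_left_mono mult_pos_pos powr_gt_zero)
        then have "b k * (\<alpha> - S k) \<le> b k * (2 / (b k * b k powr \<beta>))"
          using b_pos[of k] by (intro mult_left_mono) auto
        also have "\<dots> = 2 * b k powr - \<beta>" using b_pos[of k] by (simp add: powr_minus field_simps)
        finally show ?thesis .
      qed
      ultimately have "\<bar>b k * \<alpha> + of_int (- n k)\<bar> \<le> 2 * b k powr - \<beta>"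
        using b_pos[of k] by simp
      then show "\<exists>p :: int. \<bar>2 ^ e k * \<alpha> + of_int p\<bar> \<le> 2 * (2 ^ e k) powr - \<beta>"
        unfolding b_def by blast
    qed
    moreover have "infinite (range (\<lambda>k. 2 ^ e k :: int))"
      by (intro range_inj_infinite injI) (use e_mono in \<open>auto simp: strict_mono_eq\<close>)
    ultimately show "infinite {q :: int. q > 0 \<and>
        (\<exists>p :: int. \<bar>of_int q * \<alpha> + of_int p\<bar> \<le> 2 * of_int q powr - \<beta>)}"
      using finite_subset by blast
  qed
qed

section \<open>Generic coefficients\<close>

text \<open>Since \<bar>b\<bar> \<ge> 1, the affine function is at least the distance of x from its
  zero in absolute value. The integrand is thus at most 1 plus a singular part of integral 2 on
  either side of the zero, uniformly in a, b and c.\<close>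

lemma nn_integral_inverse_sqrt_affine_le:
  fixes a b c \<delta> :: real
  assumes "\<bar>b\<bar> \<ge> 1" "\<delta> \<ge> 0"
  shows "(\<integral>\<^sup>+x. ennreal (\<bar>a + x * b\<bar> powr (-1/2)) * indicator {c..c + \<delta>} x \<partial>lborel) \<le> ennreal (\<delta> + 4)"
proof -
  define h :: "real \<Rightarrow> real" where "h = (\<lambda>y. if y \<in> {0..1} then y powr (-1/2) else 0)"
  have h_borel [measurable]: "h \<in> borel_measurable borel"
    unfolding h_def by measurable
  have "((\<lambda>y::real. y powr (-1/2)) has_integral 2) {0..1}"
    using has_integral_powr_from_0[of "-1/2" 1] by simp
  then have "(h has_integral 2) UNIV"
    unfolding h_def by (simp only: has_integral_restrict_UNIV)
  then have h_int: "(\<integral>\<^sup>+y. ennreal (h y) \<partial>lborel) = ennreal 2"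
    by (intro nn_integral_has_integral_lborel) (auto simp: h_def)
  have h_shift: "(\<integral>\<^sup>+x. ennreal (h (t + s * x)) \<partial>lborel) = ennreal 2" if "\<bar>s\<bar> = 1" for t s :: real
  proof -
    have "s \<noteq> 0" using that by auto
    then show ?thesis
      using nn_integral_real_affine[of "\<lambda>y. ennreal (h y)" s t] that h_int by simp
  qed
  define t where "t = a / b"
  have b0: "b \<noteq> 0" using assms by auto
  have bound: "ennreal (\<bar>a + x * b\<bar> powr (-1/2)) * indicator {c..c + \<delta>} x
      \<le> indicator {c..c + \<delta>} x + (ennreal (h (t + 1 * x)) + ennreal (h (- t + (-1) * x)))" for x
  proof (cases "x \<in> {c..c + \<delta>}")
    case True
    define y where "y = t + x"
    have ab: "a + x * b = y * b" using b0 by (simp add: y_def t_def field_simps)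
    \<comment> \<open>At the zero itself \<open>powr\<close> takes the default value 0, so the bound
      holds there too.\<close>
    have "\<bar>a + x * b\<bar> powr (-1/2) \<le> 1 + (h y + h (- y))"
    proof (cases "y = 0")
      case False
      have "\<bar>y\<bar> * 1 \<le> \<bar>y\<bar> * \<bar>b\<bar>" using assms by (intro mult_left_mono) auto
      then have "\<bar>y\<bar> \<le> \<bar>a + x * b\<bar>" by (simp add: ab abs_mult)
      then have "\<bar>a + x * b\<bar> powr (-1/2) \<le> \<bar>y\<bar> powr (-1/2)"
        using False by (intro powr_mono2') auto
      also have "\<dots> \<le> 1 + (h y + h (- y))"
      proof (cases "\<bar>y\<bar> \<le> 1")
        case True
        then show ?thesis by (auto simp: h_def abs_if)
      next
        case False
        have "\<bar>y\<bar> powr (-1/2) \<le> \<bar>y\<bar> powr 0"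
          using False by (intro powr_mono) auto
        moreover have "h y \<ge> 0" "h (- y) \<ge> 0" by (auto simp: h_def)
        moreover have "\<bar>y\<bar> powr 0 = 1" using \<open>y \<noteq> 0\<close> by simp
        ultimately show ?thesis by linarith
      qed
      finally show ?thesis .
    qed (simp add: ab h_def)
    then have "ennreal (\<bar>a + x * b\<bar> powr (-1/2)) \<le> ennreal (1 + (h y + h (- y)))"
      by (rule ennreal_leI)
    also have "\<dots> = 1 + (ennreal (h y) + ennreal (h (- y)))"
      by (subst ennreal_plus, auto simp: h_def)+
    finally show ?thesis using True by (simp add: y_def)
  qed simp
  have "(\<integral>\<^sup>+x. ennreal (\<bar>a + x * b\<bar> powr (-1/2)) * indicator {c..c + \<delta>} x \<partial>lborel)
      \<le> (\<integral>\<^sup>+x. indicator {c..c + \<delta>} x + (ennreal (h (t + 1 * x)) + ennreal (h (- t + (-1) * x))) \<partial>lborel)"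
    by (intro nn_integral_mono bound)
  also have "\<dots> = (\<integral>\<^sup>+x. indicator {c..c + \<delta>} x \<partial>lborel)
      + ((\<integral>\<^sup>+x. ennreal (h (t + 1 * x)) \<partial>lborel) + (\<integral>\<^sup>+x. ennreal (h (- t + (-1) * x)) \<partial>lborel))"
    by (subst nn_integral_add, measurable)+
  also have "\<dots> = ennreal \<delta> + (ennreal 2 + ennreal 2)"
    using assms by (subst (1 2) h_shift) auto
  also have "\<dots> = ennreal (\<delta> + 4)"
    using assms by (simp add: ennreal_plus[symmetric] del: ennreal_plus ennreal_numeral)
  finally show ?thesis .
qed

lemma AE_lborel_interval_obtain:
  fixes c \<delta> :: real
  assumes "AE x in lborel. P x" "\<delta> > 0"
  obtains x where "c \<le> x" "x \<le> c + \<delta>" "P x"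
proof -
  obtain N where N: "N \<in> null_sets lborel" "{x. \<not> P x} \<subseteq> N"
    using assms(1) unfolding eventually_ae_filter by auto
  have "\<not> {c..c + \<delta>} \<subseteq> N"
  proof
    assume "{c..c + \<delta>} \<subseteq> N"
    then have "emeasure lborel {c..c + \<delta>} \<le> emeasure lborel N"
      using N by (intro emeasure_mono) auto
    then show False using null_setsD1[OF N(1)] assms(2) by simp
  qed
  then obtain x where "x \<in> {c..c + \<delta>}" "x \<notin> N" by blast
  then show thesis using N(2) that[of x] by auto
qed

text \<open>By Tonelli, the integral over \<xi> of the weighted sum is at most \<delta> + 4 times
  the sum of the weights, so the sum is finite for almost every \<xi> in the interval.\<close>

lemma choose_coefficient:
  fixes w a :: "'i::countable \<Rightarrow> real" and b :: "'i \<Rightarrow> int" and c \<delta> :: real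
  assumes w: "integrable (count_space UNIV) w" "\<And>i. w i \<ge> 0"
    and \<delta>: "\<delta> > 0"
  obtains \<xi> where "c \<le> \<xi>" "\<xi> \<le> c + \<delta>" "\<forall>i. b i \<noteq> 0 \<longrightarrow> a i + \<xi> * of_int (b i) \<noteq> 0"
    "integrable (count_space UNIV) (\<lambda>i. w i * (if b i = 0 then 1 else \<bar>a i + \<xi> * of_int (b i)\<bar> powr (-1/2)))"
proof -
  define g where "g i x = (if b i = 0 then 1 else \<bar>a i + x * of_int (b i)\<bar> powr (-1/2))" for i x
  have g_borel [measurable]: "g i \<in> borel_measurable borel" for i
    unfolding g_def by measurable
  have g_int: "(\<integral>\<^sup>+x. ennreal (g i x) * indicator {c..c + \<delta>} x \<partial>lborel) \<le> ennreal (\<delta> + 4)" for i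
  proof (cases "b i = 0")
    case True
    then show ?thesis using \<delta> by (simp add: g_def)
  next
    case False
    then have "\<bar>real_of_int (b i)\<bar> \<ge> 1" by linarith
    then show ?thesis
      using False nn_integral_inverse_sqrt_affine_le[of "of_int (b i)" \<delta> "a i" c] \<delta> by (simp add: g_def)
  qed
  define G where "G i x = ennreal (w i) * (ennreal (g i x) * indicator {c..c + \<delta>} x)" for i x
  have G_borel [measurable]: "G i \<in> borel_measurable lborel" for i
    unfolding G_def by measurable
  have "(\<integral>\<^sup>+x. (\<integral>\<^sup>+i. G i x \<partial>count_space UNIV) \<partial>lborel) = (\<integral>\<^sup>+i. (\<integral>\<^sup>+x. G i x \<partial>lborel) \<partial>count_space UNIV)"
    by (intro nn_integral_count_space_nn_integral) auto
  also have "\<dots> \<le> (\<integral>\<^sup>+i. ennreal (w i) * ennreal (\<delta> + 4) \<partial>count_space UNIV)"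
    unfolding G_def by (intro nn_integral_mono, subst nn_integral_cmult) (auto intro!: mult_left_mono g_int)
  also have "\<dots> = (\<integral>\<^sup>+i. ennreal (w i) \<partial>count_space UNIV) * ennreal (\<delta> + 4)"
    by (subst nn_integral_multc) auto
  also have "\<dots> < \<infinity>"
    using w by (auto simp: integrable_iff_bounded ennreal_mult_less_top)
  finally have "(\<integral>\<^sup>+x. (\<integral>\<^sup>+i. G i x \<partial>count_space UNIV) \<partial>lborel) \<noteq> \<infinity>" by simp
  \<comment> \<open>Countability of the index type gives the joint measurability of
    \<open>G\<close>.\<close>
  moreover have "(\<lambda>x. \<integral>\<^sup>+i. G i x \<partial>count_space UNIV) \<in> borel_measurable lborel"
  proof (rule sigma_finite_measure.borel_measurable_nn_integral[OF sigma_finite_measure_count_space])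
    have "(\<lambda>(i, x). G i x) \<in> borel_measurable (count_space UNIV \<Otimes>\<^sub>M lborel)"
      by (rule measurable_pair_measure_countable1) auto
    then show "(\<lambda>(x, i). G i x) \<in> borel_measurable (lborel \<Otimes>\<^sub>M count_space UNIV)"
      by (subst measurable_pair_swap_iff) (simp add: case_prod_beta)
  qed
  ultimately have fin: "AE x in lborel. (\<integral>\<^sup>+i. G i x \<partial>count_space UNIV) \<noteq> \<infinity>"
    by (intro nn_integral_PInf_AE)
  \<comment> \<open>Zeros have to be excluded separately: as \<open>0 powr (-1/2)\<close> is 0, a
    vanishing affine function would not make the sum infinite. Only countably many values of \<xi>
    are lost.\<close>
  have "AE x in lborel. x \<notin> range (\<lambda>i. - a i / of_int (b i))"
    by (intro AE_not_in countable_imp_null_set_lborel) auto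
  with fin have "AE x in lborel. (\<integral>\<^sup>+i. G i x \<partial>count_space UNIV) \<noteq> \<infinity> \<and> x \<notin> range (\<lambda>i. - a i / of_int (b i))"
    by eventually_elim simp
  then obtain \<xi> where \<xi>: "c \<le> \<xi>" "\<xi> \<le> c + \<delta>" "(\<integral>\<^sup>+i. G i \<xi> \<partial>count_space UNIV) \<noteq> \<infinity>"
    "\<xi> \<notin> range (\<lambda>i. - a i / of_int (b i))"
    by (rule AE_lborel_interval_obtain[OF _ \<delta>, of _ c]) blast
  show thesis
  proof (rule that[OF \<xi>(1,2)])
    have "a i + \<xi> * of_int (b i) \<noteq> 0" if "b i \<noteq> 0" for i
    proof -
      have "\<xi> \<noteq> - a i / of_int (b i)" using \<xi>(4) by blast
      then show ?thesis using that by (simp add: field_simps add_eq_0_iff)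
    qed
    then show "\<forall>i. b i \<noteq> 0 \<longrightarrow> a i + \<xi> * of_int (b i) \<noteq> 0" by blast
  next
    have "(\<integral>\<^sup>+i. ennreal (norm (w i * g i \<xi>)) \<partial>count_space UNIV) = (\<integral>\<^sup>+i. G i \<xi> \<partial>count_space UNIV)"
    proof (rule nn_integral_cong)
      fix i
      have "g i \<xi> \<ge> 0" by (simp add: g_def)
      then show "ennreal (norm (w i * g i \<xi>)) = G i \<xi>"
        using \<xi>(1,2) w(2) by (simp add: G_def ennreal_mult)
    qed
    then show "integrable (count_space UNIV) (\<lambda>i. w i * (if b i = 0 then 1 else \<bar>a i + \<xi> * of_int (b i)\<bar> powr (-1/2)))"
      using \<xi>(3) unfolding integrable_iff_bounded g_def[symmetric]
      by (simp add: top.not_eq_extremum)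
  qed
qed

definition form :: "real^'n \<Rightarrow> ('n \<Rightarrow> int) \<Rightarrow> real" where
  "form u z = (\<Sum>j\<in>UNIV. u $ j * of_int (z j))"

text \<open>The trivial value \<open>1\<close> exempts the points on which the form does not depend on the
  coefficients in \<open>J\<close>, the only ones that are being chosen.\<close>
definition inv_sqrt_form :: "'n set \<Rightarrow> real^'n \<Rightarrow> ('n \<Rightarrow> int) \<Rightarrow> real" where
  "inv_sqrt_form J u z = (if \<exists>j\<in>J. z j \<noteq> 0 then \<bar>form u z\<bar> powr (-1/2) else 1)"

lemma inv_sqrt_form_nonneg: "inv_sqrt_form J u z \<ge> 0"
  by (simp add: inv_sqrt_form_def)

text \<open>Induction on \<open>J\<close>, one coefficient at a time. Each choice stays within
  \<delta> of \<open>v\<close>, so the row remains a small perturbation of a prescribed one.\<close>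

lemma choose_row:
  fixes v :: "real^'n" and w :: "('n::finite \<Rightarrow> int) \<Rightarrow> real" and J :: "'n set"
  assumes w: "integrable (count_space UNIV) w" "\<And>z. w z \<ge> 0" and \<delta>: "\<delta> > 0"
  obtains u where "\<And>j. j \<notin> J \<Longrightarrow> u $ j = v $ j" "\<And>j. v $ j \<le> u $ j" "\<And>j. u $ j \<le> v $ j + \<delta>"
    "\<And>z j. j \<in> J \<Longrightarrow> z j \<noteq> 0 \<Longrightarrow> form u z \<noteq> 0"
    "integrable (count_space UNIV) (\<lambda>z. w z * inv_sqrt_form J u z)"
proof -
  define ok where "ok J u \<longleftrightarrow> (\<forall>j. j \<notin> J \<longrightarrow> u $ j = v $ j) \<and> (\<forall>j. v $ j \<le> u $ j \<and> u $ j \<le> v $ j + \<delta>)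
    \<and> (\<forall>z. \<forall>j\<in>J. z j \<noteq> 0 \<longrightarrow> form u z \<noteq> 0)
    \<and> integrable (count_space UNIV) (\<lambda>z. w z * inv_sqrt_form J u z)" for J and u :: "real^'n"
  have "finite J" by simp
  then have "\<exists>u. ok J u"
  proof (induction J)
    case empty
    then show ?case using w \<delta> by (intro exI[of _ v]) (simp add: ok_def inv_sqrt_form_def)
  next
    case (insert j J)
    then obtain u where "ok J u" by blast
    then have u: "\<And>k. k \<notin> J \<Longrightarrow> u $ k = v $ k"
      "\<And>k. v $ k \<le> u $ k" "\<And>k. u $ k \<le> v $ k + \<delta>"
      "\<And>z k. k \<in> J \<Longrightarrow> z k \<noteq> 0 \<Longrightarrow> form u z \<noteq> 0"
      "integrable (count_space UNIV) (\<lambda>z. w z * inv_sqrt_form J u z)"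
      unfolding ok_def by auto
    \<comment> \<open>Changing coefficient j does not affect the form at points with
      \<open>z j = 0\<close>, which keep the factor already gained. At the other points the form is
      replaced, so they restart from \<open>w\<close> and receive their factor from the new
      choice.\<close>
    define w' where "w' z = (if z j = 0 then w z * inv_sqrt_form J u z else w z)" for z
    have wu_nonneg: "w z * inv_sqrt_form J u z \<ge> 0" for z
      by (intro mult_nonneg_nonneg w inv_sqrt_form_nonneg)
    then have w'_nonneg: "w' z \<ge> 0" for z using w(2) by (simp add: w'_def)
    have "integrable (count_space UNIV) (\<lambda>z. w z * inv_sqrt_form J u z + w z)"
      by (intro Bochner_Integration.integrable_add u(5) w)
    then have "integrable (count_space UNIV) w'"
    proof (rule Bochner_Integration.integrable_bound, simp, intro AE_I2)
      fix z
      show "norm (w' z) \<le> norm (w z * inv_sqrt_form J u z + w z)"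
        using wu_nonneg[of z] w(2)[of z] by (auto simp: w'_def)
    qed
    then obtain \<xi> where \<xi>: "v $ j \<le> \<xi>" "\<xi> \<le> v $ j + \<delta>"
      "\<forall>z. z j \<noteq> 0 \<longrightarrow> (form u z - u $ j * of_int (z j)) + \<xi> * of_int (z j) \<noteq> 0"
      "integrable (count_space UNIV) (\<lambda>z. w' z * (if z j = 0 then 1
          else \<bar>(form u z - u $ j * of_int (z j)) + \<xi> * of_int (z j)\<bar> powr (-1/2)))"
      by (rule choose_coefficient[of w' \<delta> "v $ j" "\<lambda>z. z j"
          "\<lambda>z. form u z - u $ j * of_int (z j)", OF _ w'_nonneg \<delta>])
    define u' where "u' = (\<chi> k. if k = j then \<xi> else u $ k)"
    have form_u': "(form u z - u $ j * of_int (z j)) + \<xi> * of_int (z j) = form u' z" for z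
      unfolding form_def u'_def by (simp add: sum.remove[of UNIV j])
    have form_u'_0: "form u' z = form u z" if "z j = 0" for z
      using form_u'[of z] that by simp
    note \<xi>' = \<xi>(3,4)[unfolded form_u']
    have eq: "w' z * (if z j = 0 then 1 else \<bar>form u' z\<bar> powr (-1/2))
        = w z * inv_sqrt_form (insert j J) u' z" for z
      by (auto simp: w'_def inv_sqrt_form_def form_u'_0)
    show ?case
    unfolding ok_def
    proof (intro exI[of _ u'] conjI allI ballI impI)
      fix z :: "'n \<Rightarrow> int" and k assume "k \<in> insert j J" "z k \<noteq> 0"
      then show "form u' z \<noteq> 0"
        using \<xi>'(1) u(4)[of k z] form_u'_0[of z] by (cases "z j = 0") auto
    next
      show "integrable (count_space UNIV) (\<lambda>z. w z * inv_sqrt_form (insert j J) u' z)"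
        using \<xi>'(2) unfolding eq .
    qed (use \<xi>(1,2) u in \<open>auto simp: u'_def\<close>)
  qed
  then obtain u where "ok J u" by blast
  then show thesis unfolding ok_def by (intro that[of u]) auto
qed

text \<open>Rows are chosen successively, the weight for each new row being \<open>w\<close> times
  the factors of the rows already chosen. The set \<open>J i\<close> depends on the row because one
  row has to keep two prescribed coefficients.\<close>

lemma choose_matrix:
  fixes V :: "'n::finite \<Rightarrow> real^'n" and w :: "('n \<Rightarrow> int) \<Rightarrow> real" and J :: "'n \<Rightarrow> 'n set"
  assumes w: "integrable (count_space UNIV) w" "\<And>z. w z \<ge> 0" and \<delta>: "\<delta> > 0"
  obtains A :: "real^'n^'n" where "\<And>i j. j \<notin> J i \<Longrightarrow> A $ i $ j = V i $ j"
    "\<And>i j. V i $ j \<le> A $ i $ j" "\<And>i j. A $ i $ j \<le> V i $ j + \<delta>"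
    "\<And>i z j. j \<in> J i \<Longrightarrow> z j \<noteq> 0 \<Longrightarrow> form (A $ i) z \<noteq> 0"
    "integrable (count_space UNIV) (\<lambda>z. w z * (\<Prod>i\<in>UNIV. inv_sqrt_form (J i) (A $ i) z))"
proof -
  define ok where "ok R U \<longleftrightarrow> (\<forall>i\<in>R. (\<forall>j. j \<notin> J i \<longrightarrow> U i $ j = V i $ j)
      \<and> (\<forall>j. V i $ j \<le> U i $ j \<and> U i $ j \<le> V i $ j + \<delta>)
      \<and> (\<forall>z. \<forall>j\<in>J i. z j \<noteq> 0 \<longrightarrow> form (U i) z \<noteq> 0))" for R and U :: "'n \<Rightarrow> real^'n"
  have "\<exists>U. ok R U \<and> integrable (count_space UNIV) (\<lambda>z. w z * (\<Prod>i\<in>R. inv_sqrt_form (J i) (U i) z))"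
    if "finite R" for R
    using that
  proof (induction R)
    case empty
    then show ?case using w by (simp add: ok_def)
  next
    case (insert i R)
    then obtain U where U: "ok R U"
      "integrable (count_space UNIV) (\<lambda>z. w z * (\<Prod>i\<in>R. inv_sqrt_form (J i) (U i) z))" by blast
    have "w z * (\<Prod>i\<in>R. inv_sqrt_form (J i) (U i) z) \<ge> 0" for z
      using w(2) inv_sqrt_form_nonneg by (intro mult_nonneg_nonneg prod_nonneg) auto
    from choose_row[OF U(2) this \<delta>, of "J i" "V i"] obtain u where
      u: "\<And>j. j \<notin> J i \<Longrightarrow> u $ j = V i $ j" "\<And>j. V i $ j \<le> u $ j" "\<And>j. u $ j \<le> V i $ j + \<delta>"
      "\<And>z j. j \<in> J i \<Longrightarrow> z j \<noteq> 0 \<Longrightarrow> form u z \<noteq> 0"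
      "integrable (count_space UNIV) (\<lambda>z. w z * (\<Prod>i\<in>R. inv_sqrt_form (J i) (U i) z) * inv_sqrt_form (J i) u z)"
      by blast
    have "(\<Prod>k\<in>R. inv_sqrt_form (J k) ((U(i := u)) k) z) = (\<Prod>k\<in>R. inv_sqrt_form (J k) (U k) z)" for z
      using insert.hyps by (intro prod.cong) auto
    then have "w z * (\<Prod>k\<in>insert i R. inv_sqrt_form (J k) ((U(i := u)) k) z)
        = w z * (\<Prod>i\<in>R. inv_sqrt_form (J i) (U i) z) * inv_sqrt_form (J i) u z" for z
      using insert.hyps by (simp add: mult_ac)
    then have "integrable (count_space UNIV) (\<lambda>z. w z * (\<Prod>k\<in>insert i R. inv_sqrt_form (J k) ((U(i := u)) k) z))"
      using u(5) by presburger
    moreover have "ok (insert i R) (U(i := u))"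
      using U(1) u(1-4) insert.hyps unfolding ok_def by (auto split: if_splits)
    ultimately show ?case by blast
  qed
  from this[of UNIV] obtain U where U: "ok UNIV U"
    "integrable (count_space UNIV) (\<lambda>z. w z * (\<Prod>i\<in>UNIV. inv_sqrt_form (J i) (U i) z))" by auto
  define A :: "real^'n^'n" where "A = (\<chi> i. U i)"
  have A: "A $ i = U i" for i by (simp add: A_def)
  show thesis
    by (rule that[of A]; unfold A) (use U in \<open>auto simp: ok_def\<close>)
qed

section \<open>Summability of the weight over integer vectors\<close>

lemma abs_summable_int_powr:
  assumes "p > 1"
  shows "Infinite_Set_Sum.abs_summable_on (\<lambda>k::int. (1 + \<bar>of_int k\<bar>) powr - p :: real) (UNIV)"
proof -
  have nat: "Infinite_Set_Sum.abs_summable_on (\<lambda>n::nat. (1 + real n) powr - p) (UNIV)"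
  proof -
    have "summable (\<lambda>n. real (Suc n) powr - p)"
      using assms by (subst summable_Suc_iff) (simp add: summable_real_powr_iff)
    then show ?thesis by (simp add: abs_summable_on_nat_iff' add.commute)
  qed
  have "Infinite_Set_Sum.abs_summable_on (\<lambda>k::int. (1 + \<bar>of_int k\<bar>) powr - p :: real) (range int)"
    by (subst abs_summable_on_reindex_iff[symmetric]) (use nat in \<open>auto simp: inj_on_def\<close>)
  moreover have "Infinite_Set_Sum.abs_summable_on (\<lambda>k::int. (1 + \<bar>of_int k\<bar>) powr - p :: real) (range (\<lambda>n. - int n))"
    by (subst abs_summable_on_reindex_iff[symmetric]) (use nat in \<open>auto simp: inj_on_def\<close>)
  ultimately have "Infinite_Set_Sum.abs_summable_on (\<lambda>k::int. (1 + \<bar>of_int k\<bar>) powr - p :: real) (range int \<union> range (\<lambda>n. - int n))"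
    by (rule abs_summable_on_union)
  moreover have "range int \<union> range (\<lambda>n. - int n) = UNIV"
  proof -
    have "k \<in> range int \<union> range (\<lambda>n. - int n)" for k
      by (cases k rule: int_cases2) auto
    then show ?thesis by blast
  qed
  ultimately show ?thesis by simp
qed

lemma abs_summable_int_vector_powr:
  assumes "p > 1"
  shows "Infinite_Set_Sum.abs_summable_on (\<lambda>z::'n::finite \<Rightarrow> int. \<Prod>j\<in>UNIV. (1 + \<bar>real_of_int (z j)\<bar>) powr - p) (UNIV)"
  using abs_summable_on_prod_PiE[of "UNIV :: 'n set" "\<lambda>_. UNIV"
      "\<lambda>_ k. (1 + \<bar>real_of_int k\<bar>) powr - p"] abs_summable_int_powr[OF assms]
  by simp

section \<open>Exponents of lattices\<close>

text \<open>The summand 1 keeps the height positive at the origin and makes it dominate every factor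
  \<open>1 + \<bar>z j\<bar>\<close> of the weight.\<close>

definition height :: "('n::finite \<Rightarrow> int) \<Rightarrow> real" where
  "height z = 1 + (\<Sum>j\<in>UNIV. \<bar>real_of_int (z j)\<bar>)"

lemma height_ge_1: "height z \<ge> 1"
  by (simp add: height_def sum_nonneg)

lemma coord_le_height: "1 + \<bar>real_of_int (z j)\<bar> \<le> height z"
  unfolding height_def using member_le_sum[of j UNIV "\<lambda>j. \<bar>real_of_int (z j)\<bar>"] by simp

lemma finite_height_le: "finite {z :: 'n::finite \<Rightarrow> int. height z \<le> R}"
proof (rule finite_subset)
  show "{z :: 'n \<Rightarrow> int. height z \<le> R} \<subseteq> PiE UNIV (\<lambda>_. {- \<lceil>R\<rceil>..\<lceil>R\<rceil>})"
  proof
    fix z :: "'n \<Rightarrow> int" assume "z \<in> {z. height z \<le> R}"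
    then have "\<bar>real_of_int (z j)\<bar> \<le> R" for j using coord_le_height[of z j] by simp
    then have "- \<lceil>R\<rceil> \<le> z j \<and> z j \<le> \<lceil>R\<rceil>" for j
      by (smt (verit) le_of_int_ceiling of_int_le_iff of_int_minus abs_le_iff)
    then show "z \<in> PiE UNIV (\<lambda>_. {- \<lceil>R\<rceil>..\<lceil>R\<rceil>})" by (simp add: PiE_UNIV_domain)
  qed
qed (simp add: finite_PiE)

lemma powr_le_imp_le_powr:
  fixes x Q s :: real
  assumes "x > 0" "s > 0" "x powr s \<le> Q"
  shows "x \<le> Q powr (1 / s)"
proof -
  have "x = (x powr s) powr (1 / s)" using assms by (simp add: powr_powr)
  also have "\<dots> \<le> Q powr (1 / s)" using assms by (intro powr_mono2) auto
  finally show ?thesis .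
qed

text \<open>Norms of nonzero lattice points are comparable to heights, and rescaling to covolume 1
  changes only constants. As \<open>Pi_prod\<close> is the d-th root of the product of the
  coordinates, order d \<gamma> for the product means order \<gamma> for
  \<open>Pi_prod\<close>.\<close>

lemma Omega_memI:
  fixes A :: "real^'n^'n" and \<gamma> c C :: real
  assumes det: "det A \<noteq> 0" and \<gamma>: "\<gamma> > 0" and c: "c > 0" and C: "C > 0"
    and lower: "\<And>z. z \<noteq> (\<lambda>_. 0) \<Longrightarrow>
      c * height z powr - (real CARD('n) * \<gamma>) \<le> (\<Prod>i\<in>UNIV. \<bar>form (A $ i) z\<bar>)"
    and upper: "infinite {z. (\<Prod>i\<in>UNIV. \<bar>form (A $ i) z\<bar>) \<le> C * height z powr - (real CARD('n) * \<gamma>)}"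
  shows "ereal \<gamma> \<in> Omega TYPE('n)"
proof -
  define d where "d = real CARD('n)"
  have d: "d > 0" by (simp add: d_def)
  define t where "t = \<bar>det A\<bar> powr (- 1 / d)"
  have t: "t > 0" using det by (simp add: t_def)
  have t_d: "t ^ CARD('n) = 1 / \<bar>det A\<bar>"
  proof -
    have "t ^ CARD('n) = t powr d" using t by (simp add: d_def powr_realpow)
    also have "\<dots> = \<bar>det A\<bar> powr - 1" using d by (simp add: t_def powr_powr)
    finally show ?thesis using det by (simp add: powr_minus_divide)
  qed
  define B :: "real^'n^'n" where "B = (\<chi> i. t *s (A $ i))"
  have "det B = t ^ CARD('n) * det A"
    using det_rows_mul[of "\<lambda>_. t" "\<lambda>i. A $ i"] by (simp add: B_def)
  then have detB: "\<bar>det B\<bar> = 1" using det by (simp add: t_d abs_mult)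
  define vec :: "('n \<Rightarrow> int) \<Rightarrow> real^'n" where "vec z = (\<chi> i. real_of_int (z i))" for z
  define pt where "pt z = B *v vec z" for z
  define P where "P z = (\<Prod>i\<in>UNIV. \<bar>form (A $ i) z\<bar>)" for z
  have P_nonneg: "P z \<ge> 0" for z by (simp add: P_def prod_nonneg)
  have pt_nth: "pt z $ i = t * form (A $ i) z" for z i
    by (simp add: pt_def vec_def B_def matrix_vector_mult_def form_def sum_distrib_left mult.assoc)
  have Pi_pt: "Pi_prod (pt z) = t * P z powr (1 / d)" for z
  proof -
    have "(\<Prod>i\<in>UNIV. \<bar>pt z $ i\<bar>) = t powr d * P z"
      using t by (simp add: pt_nth abs_mult prod.distrib P_def d_def powr_realpow)
    then have "Pi_prod (pt z) = (t powr d * P z) powr (1 / d)" by (simp add: Pi_prod_def d_def)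
    also have "\<dots> = t * P z powr (1 / d)"
      using t d P_nonneg by (simp add: powr_mult powr_powr)
    finally show ?thesis .
  qed
  have root_height: "(a * height z powr - (d * \<gamma>)) powr (1 / d) = a powr (1 / d) * height z powr - \<gamma>"
    if "a > 0" for a and z :: "'n \<Rightarrow> int"
    using that d by (simp add: powr_mult powr_powr)
  have inj_B: "inj ((*v) B)"
    using detB by (metis abs_zero inj_matrix_vector_mult invertible_det_nz zero_neq_one)
  have lin_B: "linear ((*v) B)" by simp
  obtain k where k: "k > 0" "\<And>v. k * norm v \<le> norm (B *v v)"
    using linear_inj_bounded_below_pos[OF lin_B inj_B] by blast
  obtain K where K: "K > 0" "\<And>v. norm (B *v v) \<le> K * norm v"
    using linear_bounded_pos[OF lin_B] by blast
  have inj_pt: "inj pt"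
  proof (rule injI)
    fix z z' assume "pt z = pt z'"
    then have "vec z = vec z'" using inj_B by (simp add: pt_def inj_eq)
    then show "z = z'" by (simp add: vec_def vec_eq_iff fun_eq_iff)
  qed
  have norm_hi: "norm (pt z) \<le> K * height z" for z
  proof -
    have "norm (vec z) \<le> height z"
      using norm_le_l1_cart[of "vec z"] by (simp add: vec_def height_def)
    then have "K * norm (vec z) \<le> K * height z" using K(1) by (intro mult_left_mono) auto
    then show ?thesis using K(2)[of "vec z"] by (simp add: pt_def)
  qed
  define k' where "k' = k / (1 + d)"
  have k': "k' > 0" using k d by (simp add: k'_def)
  \<comment> \<open>The origin is excluded because its height is 1 while its norm is 0.\<close>
  have norm_lo: "k' * height z \<le> norm (pt z)" if z: "z \<noteq> (\<lambda>_. 0)" for z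
  proof -
    have nth: "\<bar>real_of_int (z j)\<bar> \<le> norm (vec z)" for j
      using component_le_norm_cart[of "vec z" j] by (simp add: vec_def)
    obtain j where "z j \<noteq> 0" using z by (auto simp: fun_eq_iff)
    then have "1 \<le> \<bar>real_of_int (z j)\<bar>" by linarith
    then have "1 \<le> norm (vec z)" using nth[of j] by linarith
    moreover have "(\<Sum>j\<in>UNIV. \<bar>real_of_int (z j)\<bar>) \<le> d * norm (vec z)"
      using sum_bounded_above[of UNIV "\<lambda>j. \<bar>real_of_int (z j)\<bar>" "norm (vec z)"] nth by (simp add: d_def)
    ultimately have "height z \<le> (1 + d) * norm (vec z)" by (simp add: height_def algebra_simps)
    then have "k' * height z \<le> k' * ((1 + d) * norm (vec z))" using k' by (intro mult_left_mono) auto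
    also have "\<dots> = k * norm (vec z)" using d by (simp add: k'_def)
    also have "\<dots> \<le> norm (pt z)" using k by (simp add: pt_def)
    finally show ?thesis .
  qed
  define S where "S g = {x \<in> range pt. Pi_prod x \<le> norm x powr - g}" for g
  have S_fin: "finite (S g)" if g: "g > \<gamma>" for g
  proof -
    \<comment> \<open>Obtained by solving \<open>t * c powr (1 / d) * H powr - \<gamma> \<le> (k' *
      H) powr - g\<close> for \<open>H powr (g - \<gamma>)\<close>.\<close>
    define Q where "Q = k' powr - g / (t * c powr (1 / d))"
    have "S g \<subseteq> pt ` ({\<lambda>_. 0} \<union> {z. height z \<le> Q powr (1 / (g - \<gamma>))})"
    proof
      fix x assume "x \<in> S g"
      then obtain z where x: "x = pt z" and le: "Pi_prod (pt z) \<le> norm (pt z) powr - g"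
        by (auto simp: S_def)
      have "height z \<le> Q powr (1 / (g - \<gamma>))" if z: "z \<noteq> (\<lambda>_. 0)"
      proof (rule powr_le_imp_le_powr)
        have h: "height z > 0" using height_ge_1[of z] by linarith
        have "t * (c powr (1 / d) * height z powr - \<gamma>) \<le> t * P z powr (1 / d)"
          using lower[OF z] t c d unfolding root_height[OF c, symmetric]
          by (intro mult_left_mono powr_mono2) (auto simp: P_def d_def)
        also have "\<dots> \<le> norm (pt z) powr - g" using le by (simp add: Pi_pt)
        also have "\<dots> \<le> (k' * height z) powr - g"
          using norm_lo[OF z] k' h g \<gamma> by (intro powr_mono2') auto
        also have "\<dots> = k' powr - g * height z powr - g" using k' h by (simp add: powr_mult)
        finally have "t * (c powr (1 / d) * height z powr - \<gamma>) * height z powr g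
            \<le> k' powr - g * height z powr - g * height z powr g"
          by (rule mult_right_mono) simp
        also have "\<dots> = k' powr - g" using h by (simp add: powr_minus)
        finally show "height z powr (g - \<gamma>) \<le> Q"
          using h t c k' by (simp add: Q_def powr_diff powr_minus field_simps)
      qed (use g height_ge_1[of z] in auto)
      then show "x \<in> pt ` ({\<lambda>_. 0} \<union> {z. height z \<le> Q powr (1 / (g - \<gamma>))})"
        using x by blast
    qed
    then show ?thesis by (rule finite_subset) (simp add: finite_height_le)
  qed
  have S_inf: "infinite (S g)" if g: "0 < g" "g < \<gamma>" for g
  proof -
    define Q where "Q = t * C powr (1 / d) * K powr g"
    \<comment> \<open>Beyond this height the power \<open>height z powr (\<gamma> - g)\<close>
      absorbs all constants; the 1 discards the origin, whose height is exactly 1.\<close>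
    define R where "R = max 1 (Q powr (1 / (\<gamma> - g)))"
    define D where "D = {z. P z \<le> C * height z powr - (d * \<gamma>)} - {z. height z \<le> R}"
    have "infinite D"
      unfolding D_def by (rule Diff_infinite_finite[OF finite_height_le]) (use upper in \<open>simp add: P_def d_def\<close>)
    then have "infinite (pt ` D)" using inj_pt by (meson finite_imageD inj_on_subset subset_UNIV)
    moreover have "pt ` D \<subseteq> S g"
    proof clarify
      fix z assume "z \<in> D"
      then have Pz: "P z \<le> C * height z powr - (d * \<gamma>)" and R: "height z > R" by (auto simp: D_def)
      have h: "height z > 0" using height_ge_1[of z] by linarith
      have z: "z \<noteq> (\<lambda>_. 0)" using R by (auto simp: R_def height_def)
      have pos: "norm (pt z) > 0"
        using order_less_le_trans[OF mult_pos_pos[OF k' h] norm_lo[OF z]] .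
      have "Q \<le> height z powr (\<gamma> - g)"
      proof (rule ccontr)
        assume "\<not> ?thesis"
        then have "height z \<le> Q powr (1 / (\<gamma> - g))"
          using h g by (intro powr_le_imp_le_powr) auto
        then show False using R by (simp add: R_def)
      qed
      then have "t * (C powr (1 / d) * height z powr - \<gamma>) \<le> (K * height z) powr - g"
        using h K by (simp add: Q_def powr_mult powr_diff powr_minus field_simps)
      moreover have "t * P z powr (1 / d) \<le> t * (C powr (1 / d) * height z powr - \<gamma>)"
        unfolding root_height[OF C, symmetric] using Pz P_nonneg t d
        by (intro mult_left_mono powr_mono2) auto
      moreover have "(K * height z) powr - g \<le> norm (pt z) powr - g"
        using norm_hi pos g by (intro powr_mono2') auto
      ultimately show "pt z \<in> S g" by (simp add: S_def Pi_pt)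
    qed
    ultimately show ?thesis using finite_subset by blast
  qed
  have "dioph_exp (range pt) = ereal \<gamma>"
  proof (rule antisym)
    show "dioph_exp (range pt) \<le> ereal \<gamma>"
      unfolding dioph_exp_def S_def[symmetric] using S_fin by (intro Sup_least) force
    show "ereal \<gamma> \<le> dioph_exp (range pt)"
    proof (rule dense_le)
      fix y assume "y < ereal \<gamma>"
      \<comment> \<open>\<open>S_inf\<close> covers positive g only, so y is first raised to at
        least 0.\<close>
      then have "max y 0 < ereal \<gamma>" using \<gamma> by simp
      then obtain g where g: "max y 0 < ereal g" "ereal g < ereal \<gamma>" using ereal_dense2 by blast
      then have "infinite (S g)" by (intro S_inf) auto
      then have "ereal g \<le> dioph_exp (range pt)"
        unfolding dioph_exp_def S_def[symmetric] by (intro Sup_upper) auto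
      then show "y \<le> dioph_exp (range pt)" using g(1) by (meson less_imp_le max.strict_boundedE order_trans)
    qed
  qed
  moreover have "unimodular_lattice (range pt)"
    unfolding unimodular_lattice_def using detB by (intro exI[of _ B]) (simp add: pt_def vec_def fun_eq_iff)
  ultimately show ?thesis unfolding Omega_def by force
qed

text \<open>In the integer lattice all points of a coordinate axis have a zero coordinate, so their
  product vanishes and they satisfy the inequality for every exponent.\<close>

lemma infinity_in_Omega:
  assumes "CARD('n::finite) \<ge> 2"
  shows "\<infinity> \<in> Omega TYPE('n)"
proof -
  define vec :: "('n \<Rightarrow> int) \<Rightarrow> real^'n" where "vec z = (\<chi> i. real_of_int (z i))" for z
  obtain i j :: 'n where ij: "i \<noteq> j"
    using assms card_2_iff' ex_card[of 2 "UNIV :: 'n set"] by (metis UNIV_I)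
  have "infinite {x \<in> range vec. Pi_prod x \<le> norm x powr - g}" for g
  proof -
    define v where "v m = vec (\<lambda>k. if k = j then int m else 0)" for m
    have "inj v"
    proof (rule injI)
      fix m m' assume "v m = v m'"
      then have "v m $ j = v m' $ j" by simp
      then show "m = m'" by (simp add: v_def vec_def)
    qed
    then have "infinite (range v)" by (rule range_inj_infinite)
    moreover have "range v \<subseteq> {x \<in> range vec. Pi_prod x \<le> norm x powr - g}"
    proof clarify
      fix m
      have "v m $ i = 0" using ij by (simp add: v_def vec_def)
      then have "(\<Prod>i\<in>UNIV. \<bar>v m $ i\<bar>) = 0" by (intro prod_zero) auto
      then have "Pi_prod (v m) = 0" by (simp only: Pi_prod_def) simp
      then show "v m \<in> range vec \<and> Pi_prod (v m) \<le> norm (v m) powr - g"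
        by (simp add: v_def)
    qed
    ultimately show ?thesis using finite_subset by blast
  qed
  then have "dioph_exp (range vec) = Sup (range ereal)" by (simp add: dioph_exp_def)
  also have "\<dots> = \<infinity>" by (intro SUP_PInfty) (meson UNIV_I ereal_less_eq(3) less_imp_le reals_Archimedean2)
  finally have "dioph_exp (range vec) = \<infinity>" .
  moreover have "unimodular_lattice (range vec)"
    unfolding unimodular_lattice_def by (intro exI[of _ "mat 1"]) (simp add: vec_def)
  ultimately show ?thesis unfolding Omega_def by force
qed

section \<open>Perturbed determinants and lower bounds for products\<close>

lemma det_nonzero_near:
  fixes V :: "real^'n^'n"
  assumes "det V \<noteq> 0"
  obtains \<delta> where "\<delta> > 0" "\<And>A :: real^'n^'n. (\<And>i j. \<bar>A $ i $ j - V $ i $ j\<bar> \<le> \<delta>) \<Longrightarrow> det A \<noteq> 0"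
proof -
  have "isCont (det :: real^'n^'n \<Rightarrow> real) V"
    unfolding det_def by (intro continuous_intros)
  then obtain e where e: "e > 0" "\<And>A. dist A V < e \<Longrightarrow> dist (det A) (det V) < \<bar>det V\<bar>"
    using assms unfolding continuous_at_eps_delta by (metis zero_less_abs_iff)
  define m where "m = real CARD('n)"
  have m: "m > 0" by (simp add: m_def)
  show thesis
  proof
    \<comment> \<open>The norm of a matrix is at most the sum of the absolute values of its
      \<open>m * m\<close> entries, here at most e / 2.\<close>
    show "e / (2 * (m * m)) > 0" using e m by simp
    fix A :: "real^'n^'n" assume A: "\<And>i j. \<bar>A $ i $ j - V $ i $ j\<bar> \<le> e / (2 * (m * m))"
    have row: "norm ((A - V) $ i) \<le> m * (e / (2 * (m * m)))" for i
    proof -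
      have "norm ((A - V) $ i) \<le> (\<Sum>j\<in>UNIV. \<bar>(A - V) $ i $ j\<bar>)" by (rule norm_le_l1_cart)
      also have "\<dots> \<le> m * (e / (2 * (m * m)))"
        unfolding m_def by (rule sum_bounded_above) (use A in \<open>simp add: m_def\<close>)
      finally show ?thesis .
    qed
    have "norm (A - V) \<le> (\<Sum>i\<in>UNIV. norm ((A - V) $ i))"
      unfolding norm_vec_def[of "A - V"] by (intro L2_set_le_sum) simp
    also have "\<dots> \<le> m * (m * (e / (2 * (m * m))))"
      unfolding m_def by (rule sum_bounded_above) (use row in \<open>simp add: m_def\<close>)
    also have "\<dots> < e" using e m by (simp add: field_simps)
    finally have "dist A V < e" by (simp add: dist_norm)
    from e(2)[OF this] show "det A \<noteq> 0" by (auto simp: dist_real_def)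
  qed
qed

text \<open>No term exceeds the sum of the absolute values; adding 1 makes the bound positive, so
  that it can serve as a divisor.\<close>

lemma integrable_count_space_bounded:
  fixes f :: "'i \<Rightarrow> real"
  assumes "integrable (count_space UNIV) f"
  obtains K where "K > 0" "\<And>i. f i \<le> K"
proof
  have fin: "(\<integral>\<^sup>+i. ennreal (norm (f i)) \<partial>count_space UNIV) < \<infinity>"
    using assms by (simp add: integrable_iff_bounded)
  show "enn2real (\<integral>\<^sup>+i. ennreal (norm (f i)) \<partial>count_space UNIV) + 1 > 0"
    by (simp add: add_nonneg_pos)
  fix i
  have "ennreal (norm (f i)) \<le> (\<integral>\<^sup>+i. ennreal (norm (f i)) \<partial>count_space UNIV)"
    by (rule nn_integral_ge_point) simp
  then have "enn2real (ennreal (norm (f i))) \<le> enn2real (\<integral>\<^sup>+i. ennreal (norm (f i)) \<partial>count_space UNIV)"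
    using fin by (intro enn2real_mono) (auto simp: top.not_eq_extremum)
  then show "f i \<le> enn2real (\<integral>\<^sup>+i. ennreal (norm (f i)) \<partial>count_space UNIV) + 1" by simp
qed

text \<open>With Y the product, the hypothesis reads w / sqrt Y \<le> K; solve for Y. This turns a
  bounded term of the weighted sum into a lower bound for the product of forms.\<close>

lemma prod_lower_bound_of_inv_sqrt:
  fixes y :: "'a \<Rightarrow> real"
  assumes "finite R" "\<And>i. i \<in> R \<Longrightarrow> y i > 0" "w \<ge> 0" "K > 0"
    and le: "w * (\<Prod>i\<in>R. y i powr (-1/2)) \<le> K"
  shows "w\<^sup>2 / K\<^sup>2 \<le> (\<Prod>i\<in>R. y i)"
proof -
  define Y where "Y = (\<Prod>i\<in>R. y i)"
  have Y: "Y > 0" using assms by (simp add: Y_def prod_pos)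
  have "(\<Prod>i\<in>R. y i powr (-1/2)) = Y powr (-1/2)" by (simp only: Y_def prod_powr_distrib)
  also have "\<dots> = 1 / sqrt Y" using Y by (simp add: powr_minus_divide powr_half_sqrt)
  finally have "w * (1 / sqrt Y) \<le> K" using le by (simp only:)
  then have "w \<le> K * sqrt Y" using Y by (simp add: field_simps)
  then have "w\<^sup>2 \<le> (K * sqrt Y)\<^sup>2" using assms by (intro power_mono) auto
  then show ?thesis using Y assms by (simp add: power_mult_distrib field_simps flip: Y_def)
qed

lemma weight_ge_height_powr:
  fixes z :: "'n::finite \<Rightarrow> int"
  assumes "p \<ge> 0"
  shows "height z powr - (real CARD('n) * p) \<le> (\<Prod>j\<in>UNIV. (1 + \<bar>real_of_int (z j)\<bar>) powr - p)"
proof -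
  have h: "height z > 0" using height_ge_1[of z] by linarith
  have "height z powr - (real CARD('n) * p) = (height z powr - p) powr real CARD('n)"
    by (simp add: powr_powr mult.commute)
  also have "\<dots> = (\<Prod>j\<in>(UNIV :: 'n set). height z powr - p)"
    using h by (simp add: powr_realpow)
  also have "\<dots> \<le> (\<Prod>j\<in>UNIV. (1 + \<bar>real_of_int (z j)\<bar>) powr - p)"
    using assms coord_le_height[of z] by (intro prod_mono conjI powr_mono2') auto
  finally show ?thesis .
qed

section \<open>Lattices with a prescribed finite exponent\<close>

lemma real_in_Omega:
  fixes \<gamma> :: real
  assumes card: "CARD('n::finite) \<ge> 2" and \<gamma>: "\<gamma> > 2"
  shows "ereal \<gamma> \<in> Omega TYPE('n)"
proof -
  define d where "d = real CARD('n)"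
  have d2: "d \<ge> 2" using card by (simp add: d_def)
  define \<beta> where "\<beta> = d * \<gamma> + d - 1"
  have "d * \<gamma> \<ge> 2 * 2" using d2 \<gamma> by (intro mult_mono) auto
  then have \<beta>: "\<beta> \<ge> 2" using d2 by (simp add: \<beta>_def)
  obtain \<alpha> c C :: real where \<alpha>: "0 \<le> \<alpha>" "\<alpha> \<le> 1" and c: "c > 0"
    and approx_lo: "\<And>p q :: int. q \<noteq> 0 \<Longrightarrow> \<bar>of_int q * \<alpha> + of_int p\<bar> \<ge> c * \<bar>of_int q\<bar> powr - \<beta>"
    and approx_hi: "infinite {q :: int. q > 0 \<and> (\<exists>p :: int. \<bar>of_int q * \<alpha> + of_int p\<bar> \<le> C * of_int q powr - \<beta>)}"
    using exists_exact_irrationality_exponent[OF \<beta>] by blast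
  obtain a b :: 'n where ab: "a \<noteq> b"
    using card card_2_iff' ex_card[of 2 "UNIV :: 'n set"] by (metis UNIV_I)
  \<comment> \<open>Unperturbed forms: \<open>z a + \<alpha> * z b\<close> in row a,
    \<open>z b\<close> in row b, and \<open>z i + z b\<close> in every other row. The entries 1 in
    column b make all rows but a of the size of \<open>z b\<close> on the good
    approximations.\<close>
  define V :: "real^'n^'n" where
    "V = (\<chi> i j. if j = i then 1 else if j = b then (if i = a then \<alpha> else 1) else 0)"
  have "x = 0" if "V *v x = 0" for x
  proof -
    have row: "(V *v x) $ i = x $ i + (if i = b then 0 else (if i = a then \<alpha> else 1) * x $ b)" for i
    proof -
      have "(V *v x) $ i = (\<Sum>j\<in>UNIV. (if j = i then x $ i else 0) +
          (if j = b then (if i = b then 0 else (if i = a then \<alpha> else 1) * x $ b) else 0))"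
        unfolding V_def matrix_vector_mult_def vec_lambda_beta by (rule sum.cong) auto
      also have "\<dots> = x $ i + (if i = b then 0 else (if i = a then \<alpha> else 1) * x $ b)"
        by (simp add: sum.distrib)
      finally show ?thesis .
    qed
    have "x $ b = 0" using row[of b] that by simp
    then have "x $ i = 0" for i using row[of i] that by (simp split: if_splits)
    then show ?thesis by (simp add: vec_eq_iff)
  qed
  then have "det V \<noteq> 0"
    using matrix_left_invertible_ker[of V] invertible_left_inverse[of V] invertible_det_nz[of V] by blast
  then obtain \<delta>\<^sub>0 where \<delta>0: "\<delta>\<^sub>0 > 0"
    "\<And>A :: real^'n^'n. (\<And>i j. \<bar>A $ i $ j - V $ i $ j\<bar> \<le> \<delta>\<^sub>0) \<Longrightarrow> det A \<noteq> 0"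
    using det_nonzero_near by blast
  \<comment> \<open>With 1/4, the \<open>z a\<close> term of a form other than a is at most half of
    its \<open>z b\<close> term whenever
    \<open>\<bar>z a\<bar> \<le> 2 * \<bar>z b\<bar>\<close>.\<close>
  define \<delta> where "\<delta> = min \<delta>\<^sub>0 (1/4)"
  have \<delta>: "\<delta> > 0" "\<delta> \<le> 1/4" "\<delta> \<le> \<delta>\<^sub>0" using \<delta>0(1) by (auto simp: \<delta>_def)
  \<comment> \<open>The exponent is half of \<gamma> because the weight gets squared in the lower
    bound; \<gamma> / 2 > 1 gives summability.\<close>
  define w :: "('n \<Rightarrow> int) \<Rightarrow> real" where
    "w z = (\<Prod>j\<in>UNIV. (1 + \<bar>real_of_int (z j)\<bar>) powr - (\<gamma> / 2))" for z
  have w_nonneg: "w z \<ge> 0" for z by (simp add: w_def prod_nonneg)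
  have w_int: "integrable (count_space UNIV) w"
    using abs_summable_int_vector_powr[of "\<gamma> / 2", where 'n = 'n] \<gamma>
    by (simp add: Infinite_Set_Sum.abs_summable_on_def w_def[abs_def])
  \<comment> \<open>Row a keeps its coefficients 1 and \<alpha> at a and b exactly; everything else
    is generic.\<close>
  define J where "J i = (if i = a then UNIV - {a, b} else UNIV)" for i
  obtain A :: "real^'n^'n" where A: "\<And>i j. j \<notin> J i \<Longrightarrow> A $ i $ j = V $ i $ j"
    "\<And>i j. V $ i $ j \<le> A $ i $ j" "\<And>i j. A $ i $ j \<le> V $ i $ j + \<delta>"
    "\<And>i z j. j \<in> J i \<Longrightarrow> z j \<noteq> 0 \<Longrightarrow> form (A $ i) z \<noteq> 0"
    "integrable (count_space UNIV) (\<lambda>z. w z * (\<Prod>i\<in>UNIV. inv_sqrt_form (J i) (A $ i) z))"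
    using choose_matrix[OF w_int w_nonneg \<delta>(1), of J "\<lambda>i. V $ i"] by blast
  have detA: "det A \<noteq> 0"
  proof (rule \<delta>0(2))
    fix i j show "\<bar>A $ i $ j - V $ i $ j\<bar> \<le> \<delta>\<^sub>0"
      using A(2)[of i j] A(3)[of i j] \<delta>(3) by linarith
  qed
  obtain K where K: "K > 0" "\<And>z. w z * (\<Prod>i\<in>UNIV. inv_sqrt_form (J i) (A $ i) z) \<le> K"
    using integrable_count_space_bounded[OF A(5)] by blast
  have w_height: "height z powr - (d * \<gamma>) / K\<^sup>2 \<le> (w z)\<^sup>2 / K\<^sup>2" for z
  proof -
    have "height z powr - (d * (\<gamma> / 2)) \<le> w z"
      using weight_ge_height_powr[of "\<gamma> / 2" z] \<gamma> by (simp add: w_def d_def)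
    then have "(height z powr - (d * (\<gamma> / 2)))\<^sup>2 \<le> (w z)\<^sup>2" by (intro power_mono) auto
    moreover have "(height z powr - (d * (\<gamma> / 2)))\<^sup>2 = height z powr - (d * \<gamma>)"
      by (simp add: power2_eq_square mult.commute flip: powr_add)
    ultimately show ?thesis by (simp add: divide_right_mono)
  qed
  have form_a: "form (A $ a) z = of_int (z b) * \<alpha> + of_int (z a)"
    and form_i: "form (A $ i) z = A $ i $ a * of_int (z a) + A $ i $ b * of_int (z b)"
    if "\<forall>j. j \<noteq> a \<longrightarrow> j \<noteq> b \<longrightarrow> z j = 0" for z i
  proof -
    have *: "form (A $ i) z = A $ i $ a * of_int (z a) + A $ i $ b * of_int (z b)" for i
    proof -
      have "form (A $ i) z = (\<Sum>j\<in>{a, b}. A $ i $ j * of_int (z j))"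
        unfolding form_def using that by (intro sum.mono_neutral_right) auto
      then show ?thesis using ab by simp
    qed
    show "form (A $ i) z = A $ i $ a * of_int (z a) + A $ i $ b * of_int (z b)" by (rule *)
    have "A $ a $ a = 1" "A $ a $ b = \<alpha>" using A(1)[of a a] A(1)[of b a] ab by (auto simp: J_def V_def)
    then show "form (A $ a) z = of_int (z b) * \<alpha> + of_int (z a)" using *[of a] by simp
  qed
  have real_card: "real (CARD('n) - 1) = d - 1" using card by (simp add: d_def)
  have power_card: "x ^ (CARD('n) - 1) = x powr (d - 1)" if "x > 0" for x
    using powr_realpow[OF that, of "CARD('n) - 1"] unfolding real_card by (rule sym)
  have split_a: "(\<Prod>i\<in>UNIV. f i) = f a * (\<Prod>i\<in>UNIV - {a}. f i)" for f :: "'n \<Rightarrow> real"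
    by (simp add: prod.remove[of UNIV a])
  \<comment> \<open>The first constant serves the generic bound, the second the approximations to
    \<alpha>, where each of the d - 1 other forms is at least q / 2.\<close>
  define c' where "c' = min (1 / K\<^sup>2) (c / 2 ^ (CARD('n) - 1))"
  have c': "c' > 0" using c K by (simp add: c'_def)
  have lower: "c' * height z powr - (d * \<gamma>) \<le> (\<Prod>i\<in>UNIV. \<bar>form (A $ i) z\<bar>)"
    if z: "z \<noteq> (\<lambda>_. 0)" for z
  proof -
    have c'_K: "c' * height z powr - (d * \<gamma>) \<le> (w z)\<^sup>2 / K\<^sup>2"
    proof -
      have "c' * height z powr - (d * \<gamma>) \<le> 1 / K\<^sup>2 * height z powr - (d * \<gamma>)"
        by (intro mult_right_mono) (auto simp: c'_def)
      then show ?thesis using w_height[of z] by simp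
    qed
    obtain k where k: "z k \<noteq> 0" using z by (auto simp: fun_eq_iff)
    have form_nz: "form (A $ i) z \<noteq> 0" if "i \<noteq> a" for i
      using A(4)[of k i z] k that by (simp add: J_def)
    have inv_i: "inv_sqrt_form (J i) (A $ i) z = \<bar>form (A $ i) z\<bar> powr (-1/2)" if "i \<noteq> a" for i
      using k that by (auto simp: inv_sqrt_form_def J_def)
    show ?thesis
    proof (cases "\<exists>j\<in>J a. z j \<noteq> 0")
      \<comment> \<open>Off the a-b-plane all d forms contribute an inverse square root to the
        bounded term.\<close>
      case True
      have "(w z)\<^sup>2 / K\<^sup>2 \<le> (\<Prod>i\<in>UNIV. \<bar>form (A $ i) z\<bar>)"
      proof (rule prod_lower_bound_of_inv_sqrt)
        show "\<bar>form (A $ i) z\<bar> > 0" for i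
          using form_nz[of i] A(4)[of _ a z] True by (cases "i = a") auto
        have "inv_sqrt_form (J i) (A $ i) z = \<bar>form (A $ i) z\<bar> powr (-1/2)" for i
          using inv_i[of i] True by (cases "i = a") (auto simp: inv_sqrt_form_def)
        then show "w z * (\<Prod>i\<in>UNIV. \<bar>form (A $ i) z\<bar> powr (-1/2)) \<le> K" using K(2)[of z] by simp
      qed (use K w_nonneg in auto)
      then show ?thesis using c'_K by linarith
    next
      case False
      then have zJ: "\<forall>j. j \<noteq> a \<longrightarrow> j \<noteq> b \<longrightarrow> z j = 0" by (auto simp: J_def)
      show ?thesis
      proof (cases "\<bar>of_int (z b) * \<alpha> + of_int (z a)\<bar> \<ge> 1")
        \<comment> \<open>On the plane the factor of row a is the trivial 1. The generic bound
          controls the other d - 1 forms, and the form of row a, being at least 1 in absolute value,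
          only enlarges the product.\<close>
        case True
        have Y: "(w z)\<^sup>2 / K\<^sup>2 \<le> (\<Prod>i\<in>UNIV - {a}. \<bar>form (A $ i) z\<bar>)"
        proof (rule prod_lower_bound_of_inv_sqrt)
          show "\<bar>form (A $ i) z\<bar> > 0" if "i \<in> UNIV - {a}" for i
            using form_nz[of i] that by auto
          have "inv_sqrt_form (J a) (A $ a) z = 1" using False by (simp add: inv_sqrt_form_def)
          then have "(\<Prod>i\<in>UNIV. inv_sqrt_form (J i) (A $ i) z)
              = (\<Prod>i\<in>UNIV - {a}. \<bar>form (A $ i) z\<bar> powr (-1/2))"
            unfolding split_a using inv_i by (auto intro!: prod.cong)
          then show "w z * (\<Prod>i\<in>UNIV - {a}. \<bar>form (A $ i) z\<bar> powr (-1/2)) \<le> K" using K(2)[of z] by simp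
        qed (use K w_nonneg in auto)
        also have "\<dots> \<le> \<bar>form (A $ a) z\<bar> * (\<Prod>i\<in>UNIV - {a}. \<bar>form (A $ i) z\<bar>)"
          using mult_right_mono[OF True, of "\<Prod>i\<in>UNIV - {a}. \<bar>form (A $ i) z\<bar>"]
          by (simp add: form_a[OF zJ] prod_nonneg)
        finally show ?thesis using c'_K unfolding split_a[of "\<lambda>i. \<bar>form (A $ i) z\<bar>"] by linarith
      next
        \<comment> \<open>The first form is below 1 in absolute value, so \<open>z b\<close> is
          nonzero and controls \<open>z a\<close>. The lower bound for \<alpha> applies to row a,
          and all other forms are of size at least q / 2.\<close>
        case small: False
        define q where "q = \<bar>real_of_int (z b)\<bar>"
        have zb: "z b \<noteq> 0"
        proof
          assume "z b = 0"
          then have "\<bar>z a\<bar> < 1" using small by simp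
          then have "z a = 0" by simp
          then show False using k zJ \<open>z b = 0\<close> by metis
        qed
        then have q1: "q \<ge> 1" unfolding q_def by linarith
        have "\<bar>of_int (z b) * \<alpha>\<bar> \<le> q" unfolding abs_mult q_def using \<alpha> by (simp add: mult_left_le)
        then have za: "\<bar>real_of_int (z a)\<bar> \<le> 2 * q" using small q1 by linarith
        have ge: "q / 2 \<le> \<bar>form (A $ i) z\<bar>" if i: "i \<noteq> a" for i
        proof -
          have "V $ i $ a = 0" "V $ i $ b = 1" using i ab by (auto simp: V_def)
          then have bnds: "0 \<le> A $ i $ a" "A $ i $ a \<le> 1/4" "1 \<le> A $ i $ b"
            using A(2)[of i a] A(3)[of i a] A(2)[of i b] \<delta>(2) by auto
          have "\<bar>A $ i $ a * of_int (z a)\<bar> \<le> 1/4 * (2 * q)"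
            unfolding abs_mult using bnds za by (intro mult_mono) auto
          moreover have "1 * q \<le> \<bar>A $ i $ b * of_int (z b)\<bar>"
            unfolding abs_mult q_def using bnds by (intro mult_right_mono) auto
          ultimately show ?thesis unfolding form_i[OF zJ] by linarith
        qed
        have "c' * height z powr - (d * \<gamma>) \<le> c / 2 ^ (CARD('n) - 1) * q powr - (d * \<gamma>)"
        proof (rule mult_mono)
          have "q \<le> height z" using coord_le_height[of z b] by (simp add: q_def)
          then show "height z powr - (d * \<gamma>) \<le> q powr - (d * \<gamma>)"
            using q1 d2 \<gamma> by (intro powr_mono2') auto
        qed (use c in \<open>auto simp: c'_def\<close>)
        also have "\<dots> = (c * q powr - \<beta>) * (q / 2) ^ (CARD('n) - 1)"
        proof -
          have "q ^ (CARD('n) - 1) = q powr (d - 1)" using q1 by (intro power_card) simp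
          moreover have "q powr - (d * \<gamma>) = q powr - \<beta> * q powr (d - 1)"
            by (simp add: \<beta>_def flip: powr_add)
          ultimately show ?thesis by (simp add: power_divide)
        qed
        also have "\<dots> \<le> \<bar>form (A $ a) z\<bar> * (\<Prod>i\<in>UNIV - {a}. \<bar>form (A $ i) z\<bar>)"
        proof (rule mult_mono)
          show "c * q powr - \<beta> \<le> \<bar>form (A $ a) z\<bar>"
            unfolding form_a[OF zJ] q_def by (rule approx_lo[OF zb])
          have "(\<Prod>i\<in>UNIV - {a}. q / 2) \<le> (\<Prod>i\<in>UNIV - {a}. \<bar>form (A $ i) z\<bar>)"
            using q1 ge by (intro prod_mono) auto
          then show "(q / 2) ^ (CARD('n) - 1) \<le> (\<Prod>i\<in>UNIV - {a}. \<bar>form (A $ i) z\<bar>)"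
            by simp
        qed (use q1 in auto)
        finally show ?thesis unfolding split_a[of "\<lambda>i. \<bar>form (A $ i) z\<bar>"] .
      qed
    qed
  qed
  define C' where "C' = max C 1"
  \<comment> \<open>The middle factor converts q into the height through
    \<open>height z \<le> (3 + C') * q\<close>; the last one comes from d - 1 forms bounded by twice
    the height.\<close>
  define C'' where "C'' = C' * (3 + C') powr \<beta> * 2 ^ (CARD('n) - 1)"
  have C': "C' \<ge> 1" "C \<le> C'" by (auto simp: C'_def)
  have C'': "C'' > 0" using C' by (simp add: C''_def)
  define Z where "Z = {z. (\<Prod>i\<in>UNIV. \<bar>form (A $ i) z\<bar>) \<le> C'' * height z powr - (d * \<gamma>)}"
  \<comment> \<open>Every good denominator q is the b-coordinate of a point of \<open>Z\<close>, so
    infinitely many q force \<open>Z\<close> to be infinite.\<close>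
  have "{q :: int. q > 0 \<and> (\<exists>p :: int. \<bar>of_int q * \<alpha> + of_int p\<bar> \<le> C * of_int q powr - \<beta>)}
      \<subseteq> (\<lambda>z. z b) ` Z"
  proof clarify
    fix q p :: int
    assume q: "q > 0" and qp: "\<bar>of_int q * \<alpha> + of_int p\<bar> \<le> C * of_int q powr - \<beta>"
    define z where "z = (\<lambda>j. if j = a then p else if j = b then q else 0)"
    have zJ: "\<forall>j. j \<noteq> a \<longrightarrow> j \<noteq> b \<longrightarrow> z j = 0" by (simp add: z_def)
    have zab: "z a = p" "z b = q" using ab by (auto simp: z_def)
    have q1: "real_of_int q \<ge> 1" using q by simp
    have h: "height z > 0" using height_ge_1[of z] by linarith
    have "C * of_int q powr - \<beta> \<le> C' * of_int q powr - \<beta>" using C' by (intro mult_right_mono) auto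
    with qp have qp': "\<bar>of_int q * \<alpha> + of_int p\<bar> \<le> C' * of_int q powr - \<beta>" by linarith
    have "of_int q powr - \<beta> \<le> of_int q powr 0" using q1 \<beta> by (intro powr_mono) auto
    then have "C' * of_int q powr - \<beta> \<le> C' * 1" using C' q1 by (intro mult_left_mono) auto
    moreover have "\<bar>of_int q * \<alpha>\<bar> \<le> of_int q" using \<alpha> q1 by (simp add: abs_mult mult_left_le)
    ultimately have "\<bar>real_of_int p\<bar> \<le> of_int q + C'" using qp' by linarith
    moreover have "height z = 1 + \<bar>real_of_int p\<bar> + of_int q"
    proof -
      have "(\<Sum>j\<in>UNIV. \<bar>real_of_int (z j)\<bar>) = (\<Sum>j\<in>{a, b}. \<bar>real_of_int (z j)\<bar>)"
        using zJ by (intro sum.mono_neutral_right) auto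
      then show ?thesis using ab zab q by (simp add: height_def)
    qed
    moreover have "C' * 1 \<le> C' * of_int q" using q1 C' by (intro mult_left_mono) auto
    ultimately have hq: "height z \<le> (3 + C') * of_int q" using q1 by (simp add: distrib_right)
    have fa: "\<bar>form (A $ a) z\<bar> \<le> C' * (3 + C') powr \<beta> * height z powr - \<beta>"
    proof -
      have "((3 + C') * of_int q) powr - \<beta> \<le> height z powr - \<beta>"
        using hq h \<beta> by (intro powr_mono2') auto
      then have "(3 + C') powr - \<beta> * of_int q powr - \<beta> \<le> height z powr - \<beta>"
        using C' q1 by (simp add: powr_mult)
      then have "of_int q powr - \<beta> \<le> (3 + C') powr \<beta> * height z powr - \<beta>"
        using C' h q1 by (simp add: powr_minus field_simps)
      then have "C' * of_int q powr - \<beta> \<le> C' * ((3 + C') powr \<beta> * height z powr - \<beta>)"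
        using C' by (intro mult_left_mono) auto
      then show ?thesis using qp' unfolding form_a[OF zJ] zab by (simp add: mult.assoc)
    qed
    have fi: "\<bar>form (A $ i) z\<bar> \<le> 2 * height z" for i
    proof -
      have "\<bar>form (A $ i) z\<bar> \<le> (\<Sum>j\<in>UNIV. \<bar>A $ i $ j * of_int (z j)\<bar>)"
        unfolding form_def by (rule sum_abs)
      also have "\<dots> \<le> (\<Sum>j\<in>UNIV. 2 * \<bar>real_of_int (z j)\<bar>)"
      proof (rule sum_mono)
        fix j
        have "0 \<le> V $ i $ j" "V $ i $ j \<le> 1" using \<alpha> by (auto simp: V_def)
        then have "\<bar>A $ i $ j\<bar> \<le> 2" using A(2)[of i j] A(3)[of i j] \<delta>(2) by linarith
        then show "\<bar>A $ i $ j * of_int (z j)\<bar> \<le> 2 * \<bar>real_of_int (z j)\<bar>"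
          unfolding abs_mult by (intro mult_right_mono) auto
      qed
      also have "\<dots> \<le> 2 * height z" by (simp add: height_def sum_distrib_left)
      finally show ?thesis .
    qed
    have "\<bar>form (A $ a) z\<bar> * (\<Prod>i\<in>UNIV - {a}. \<bar>form (A $ i) z\<bar>)
        \<le> (C' * (3 + C') powr \<beta> * height z powr - \<beta>) * (\<Prod>i\<in>UNIV - {a}. 2 * height z)"
      using fa fi C' by (intro mult_mono prod_mono) (auto intro: prod_nonneg)
    also have "\<dots> = C'' * (height z powr - \<beta> * height z ^ (CARD('n) - 1))"
      by (simp add: C''_def power_mult_distrib)
    also have "height z powr - \<beta> * height z ^ (CARD('n) - 1) = height z powr - (d * \<gamma>)"
    proof -
      show ?thesis unfolding power_card[OF h] by (simp add: \<beta>_def flip: powr_add)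
    qed
    finally have "z \<in> Z" unfolding Z_def split_a[of "\<lambda>i. \<bar>form (A $ i) _\<bar>"] by simp
    then show "q \<in> (\<lambda>z. z b) ` Z" using zab by blast
  qed
  then have upper: "infinite Z" using approx_hi by (meson finite_imageI finite_subset)
  show ?thesis
    by (rule Omega_memI[OF detA _ c' C'']) (use \<gamma> lower upper in \<open>simp_all add: d_def Z_def\<close>)
qed

theorem theorem1:
  assumes "CARD('n::finite) \<ge> 3"
  shows "{ereal (3 - real CARD('n) / (real CARD('n) - 1)^2) ..} \<subseteq> Omega TYPE('n)"
proof
  fix x assume x: "x \<in> {ereal (3 - real CARD('n) / (real CARD('n) - 1)^2) ..}"
  define d where "d = real CARD('n)"
  have d: "d \<ge> 3" using assms by (simp add: d_def)
  \<comment> \<open>Since \<open>(d - 1)^2 - d = d * (d - 3) + 1\<close>, the left endpoint exceeds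
    2, the threshold of \<open>real_in_Omega\<close>.\<close>
  have "0 \<le> d * (d - 3)" using d by simp
  then have "d < (d - 1)^2" by (simp add: power2_eq_square algebra_simps)
  then have "d / (d - 1)^2 < 1" using d by simp
  then have "ereal 2 < ereal (3 - d / (d - 1)^2)" by simp
  also have "\<dots> \<le> x" using x by (simp add: d_def)
  finally have "ereal 2 < x" .
  then show "x \<in> Omega TYPE('n)"
    using real_in_Omega[where 'n = 'n] infinity_in_Omega[where 'n = 'n] assms by (cases x) auto
qed

end
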